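(* Let $X$ be a connected and locally path connected space and $x\in X$. If $\pi_1^{\tau}(X,x)$ has the indiscrete topology, then $X$ is a Spanier space.
   Context: Spanier group: for an open cover $\mathcal{U}$ of $X$, $\pi(\mathcal{U},x)\le\pi_1(X,x)$ is the subgroup of classes having a representative of the form $\prod_{j=1}^n u_j v_j u_j^{-1}$, with $u_j$ a path starting at $x$ and $v_j$ a loop based at $u_j(1)$ lying inside some $U_j\in\mathcal{U}$. Then $\pi_1^{sp}(X,x)=\bigcap_{\mathcal{U}}\pi(\mathcal{U},x)$ over all open covers $\mathcal{U}$. A space $X$ is a Spanier space if $\pi_1(X,y)=\pi_1^{sp}(X,y)$ for every $y\in X$. $\pi_1^{qtop}(X,x)$ is the group $\pi_1(X,x)$ with the quotient topology induced by the natural map $\Omega(X,x)\to\pi_1(X,x)$ from the loop space with the compact-open topology. $\pi_1^{\tau}(X,x)$ (Brazas) is the group $\pi_1(X,x)$ with the finest topology that is coarser than (or equal to) the topology of $\pi_1^{qtop}(X,x)$ and makes $\pi_1(X,x)$ a topological group. *)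

theory Defs
  imports "HOL-Analysis.Analysis" "HOL-Algebra.Group"
begin

section \<open>The fundamental group\<close>

text \<open>A space is a subset \<open>X\<close> of an arbitrary topological space, with the subspace topology.
  As in the library, a path is a map on all of \<open>\<real>\<close> whose values outside \<open>[0, 1]\<close>
  are irrelevant; \<open>homotopic_paths\<close> ignores them.\<close>

definition loops_at :: "'a::topological_space set \<Rightarrow> 'a \<Rightarrow> (real \<Rightarrow> 'a) set" where
  "loops_at X x = {p. path p \<and> path_image p \<subseteq> X \<and> pathstart p = x \<and> pathfinish p = x}"

definition path_class :: "'a::topological_space set \<Rightarrow> (real \<Rightarrow> 'a) \<Rightarrow> (real \<Rightarrow> 'a) set" where
  "path_class X p = {q. homotopic_paths X p q}"

text \<open>The union in the product is over equal classes: see \<open>pi1_mult_path_class\<close>.\<close>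

definition pi1 :: "'a::topological_space set \<Rightarrow> 'a \<Rightarrow> (real \<Rightarrow> 'a) set monoid" where
  "pi1 X x =
     \<lparr>carrier = path_class X ` loops_at X x,
      mult = (\<lambda>a b. \<Union>p\<in>a. \<Union>q\<in>b. path_class X (p +++ q)),
      one = path_class X (\<lambda>_. x)\<rparr>"

lemma path_class_eqI: "homotopic_paths X p q \<Longrightarrow> path_class X p = path_class X q"
  unfolding path_class_def
  by (rule Collect_cong) (meson homotopic_paths_trans homotopic_paths_sym)

lemma loops_at_join: "p \<in> loops_at X x \<Longrightarrow> q \<in> loops_at X x \<Longrightarrow> p +++ q \<in> loops_at X x"
  by (auto simp: loops_at_def path_image_join)

lemma loops_at_reversepath: "p \<in> loops_at X x \<Longrightarrow> reversepath p \<in> loops_at X x"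
  by (auto simp: loops_at_def)

lemma loops_at_const: "x \<in> X \<Longrightarrow> (\<lambda>_. x) \<in> loops_at X x"
  by (auto simp: loops_at_def path_def path_image_def pathstart_def pathfinish_def)

lemma pi1_mult_path_class:
  assumes "p \<in> loops_at X x" "q \<in> loops_at X x"
  shows "path_class X p \<otimes>\<^bsub>pi1 X x\<^esub> path_class X q = path_class X (p +++ q)"
proof -
  have "path_class X (p' +++ q') = path_class X (p +++ q)"
    if "p' \<in> path_class X p" "q' \<in> path_class X q" for p' q'
    using that assms
    by (intro path_class_eqI homotopic_paths_sym[OF homotopic_paths_join])
       (auto simp: path_class_def loops_at_def)
  moreover have "p \<in> path_class X p" "q \<in> path_class X q"
    using assms by (auto simp: path_class_def loops_at_def)
  ultimately have "(\<Union>p'\<in>path_class X p. \<Union>q'\<in>path_class X q. path_class X (p' +++ q'))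
      = path_class X (p +++ q)"
    by fast
  then show ?thesis
    by (simp add: pi1_def)
qed

lemma homotopic_paths_lid_const:
  fixes p :: "real \<Rightarrow> 'a::topological_space"
  assumes "p \<in> loops_at X x"
  shows "homotopic_paths X ((\<lambda>_. x) +++ p) p"
proof -
  have \<section>: "continuous_on {0..1} (\<lambda>t::real. if t \<le> 1/2 then 0 else 2 * t - 1)"
    unfolding split_01
    by (rule continuous_on_cases continuous_intros | force)+
  show ?thesis
    apply (rule homotopic_paths_sym)
    using assms \<section> unfolding loops_at_def pathstart_def pathfinish_def
    by (intro homotopic_paths_reparametrize [where f = "\<lambda>t. if t \<le> 1/2 then 0 else 2 * t - 1"])
       (auto simp: joinpaths_def)
qed

lemma homotopic_paths_rinv_const:
  fixes p :: "real \<Rightarrow> 'a::topological_space"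
  assumes "path p" "path_image p \<subseteq> X" "pathstart p = x"
  shows "homotopic_paths X (p +++ reversepath p) (\<lambda>_. x)"
proof -
  have p: "continuous_on {0..1} p" "p ` {0..1} \<subseteq> X" "p 0 = x"
    using assms by (auto simp: path_def path_image_def pathstart_def)
  define m where "m = (\<lambda>z::real \<times> real. (1 - fst z) * min (2 * snd z) (2 - 2 * snd z))"
  have m01: "m z \<in> {0..1}" if "z \<in> {0..1} \<times> {0..1}" for z
    using that unfolding m_def by (auto intro!: mult_nonneg_nonneg mult_le_one)
  have m: "continuous_on ({0..1} \<times> {0..1}) m"
    unfolding m_def by (intro continuous_intros)
  have "continuous_on ({0..1} \<times> {0..1}) (p \<circ> m)"
    using m p(1) m01 by (intro continuous_on_compose) (auto elim: continuous_on_subset)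
  moreover have "(p \<circ> m) \<in> ({0..1} \<times> {0..1}) \<rightarrow> X"
    using m01 p(2) by fastforce
  moreover have "(p \<circ> m) (0, t) = (p +++ reversepath p) t" if "t \<in> {0..1}" for t
    using that by (auto simp: m_def joinpaths_def reversepath_def min_def algebra_simps)
  ultimately show ?thesis
    unfolding homotopic_paths
    by (intro exI[of _ "p \<circ> m"])
       (auto simp: m_def p pathstart_def pathfinish_def joinpaths_def reversepath_def)
qed

lemma group_pi1:
  assumes "x \<in> X"
  shows "group (pi1 X x)"
proof (rule groupI)
  fix a b c assume "a \<in> carrier (pi1 X x)" "b \<in> carrier (pi1 X x)" "c \<in> carrier (pi1 X x)"
  then obtain p q r where pqr:
      "a = path_class X p" "b = path_class X q" "c = path_class X r"
      "p \<in> loops_at X x" "q \<in> loops_at X x" "r \<in> loops_at X x"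
    by (auto simp: pi1_def)
  show "a \<otimes>\<^bsub>pi1 X x\<^esub> b \<otimes>\<^bsub>pi1 X x\<^esub> c = a \<otimes>\<^bsub>pi1 X x\<^esub> (b \<otimes>\<^bsub>pi1 X x\<^esub> c)"
    unfolding pqr(1-3) using pqr(4-6)
      path_class_eqI[OF homotopic_paths_assoc, of p X q r]
    by (simp add: pi1_mult_path_class loops_at_join) (simp add: loops_at_def)
next
  fix a b assume "a \<in> carrier (pi1 X x)" "b \<in> carrier (pi1 X x)"
  then obtain p q where pq: "a = path_class X p" "b = path_class X q"
      "p \<in> loops_at X x" "q \<in> loops_at X x"
    by (auto simp: pi1_def)
  then show "a \<otimes>\<^bsub>pi1 X x\<^esub> b \<in> carrier (pi1 X x)"
    by (auto simp: pi1_mult_path_class loops_at_join) (simp add: pi1_def loops_at_join)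
next
  show "\<one>\<^bsub>pi1 X x\<^esub> \<in> carrier (pi1 X x)"
    using loops_at_const[OF assms] by (simp add: pi1_def)
next
  fix a assume "a \<in> carrier (pi1 X x)"
  then obtain p where p: "a = path_class X p" "p \<in> loops_at X x"
    by (auto simp: pi1_def)
  have one: "\<one>\<^bsub>pi1 X x\<^esub> = path_class X (\<lambda>_. x)"
    by (simp add: pi1_def)
  show "\<one>\<^bsub>pi1 X x\<^esub> \<otimes>\<^bsub>pi1 X x\<^esub> a = a"
    unfolding one p(1) pi1_mult_path_class[OF loops_at_const[OF assms] p(2)]
    by (rule path_class_eqI) (rule homotopic_paths_lid_const[OF p(2)])
  have "path_class X (reversepath p) \<otimes>\<^bsub>pi1 X x\<^esub> a = \<one>\<^bsub>pi1 X x\<^esub>"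
    unfolding one p(1) pi1_mult_path_class[OF loops_at_reversepath[OF p(2)] p(2)]
    using homotopic_paths_rinv_const[of "reversepath p" X x] p(2)
    by (intro path_class_eqI) (auto simp: loops_at_def)
  moreover have "path_class X (reversepath p) \<in> carrier (pi1 X x)"
    using loops_at_reversepath[OF p(2)] by (simp add: pi1_def)
  ultimately show "\<exists>y\<in>carrier (pi1 X x). y \<otimes>\<^bsub>pi1 X x\<^esub> a = \<one>\<^bsub>pi1 X x\<^esub>"
    by blast
qed


section \<open>The quotient topology on the fundamental group\<close>

definition compact_open_topology :: "'a topology \<Rightarrow> 'b topology \<Rightarrow> ('a \<Rightarrow> 'b) topology" where
  "compact_open_topology T U = topology_generated_by
     {{f \<in> extensional (topspace T). continuous_map T U f \<and> f ` K \<subseteq> W} | K W.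
        compactin T K \<and> openin U W}"

lemma topspace_compact_open_topology:
  "topspace (compact_open_topology T U) = {f \<in> extensional (topspace T). continuous_map T U f}"
proof -
  have "{f \<in> extensional (topspace T). continuous_map T U f}
        \<in> {{f \<in> extensional (topspace T). continuous_map T U f \<and> f ` K \<subseteq> W} | K W.
             compactin T K \<and> openin U W}"
    by (rule CollectI, rule exI[of _ "{}"], rule exI[of _ "{}"]) auto
  then show ?thesis
    unfolding compact_open_topology_def topology_generated_by_topspace by blast
qed

text \<open>The points of the loop space are maps on \<open>[0, 1]\<close>: of each loop only the representative
  that is \<open>undefined\<close> outside \<open>[0, 1]\<close> is kept.\<close>

definition loop_space :: "'a::topological_space set \<Rightarrow> 'a \<Rightarrow> (real \<Rightarrow> 'a) topology" where
  "loop_space X x =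
     subtopology (compact_open_topology (top_of_set {0..1}) (top_of_set X)) (loops_at X x)"

lemma topspace_loop_space: "topspace (loop_space X x) = loops_at X x \<inter> extensional {0..1}"
  by (auto simp: loop_space_def topspace_compact_open_topology loops_at_def path_def path_image_def)

definition quotient_topology :: "'a topology \<Rightarrow> ('a \<Rightarrow> 'b) \<Rightarrow> 'b topology" where
  "quotient_topology T f =
     topology (\<lambda>W. W \<subseteq> f ` topspace T \<and> openin T {a \<in> topspace T. f a \<in> W})"

lemma openin_quotient_topology:
  "openin (quotient_topology T f) W \<longleftrightarrow>
     W \<subseteq> f ` topspace T \<and> openin T {a \<in> topspace T. f a \<in> W}"
proof -
  have "istopology (\<lambda>W. W \<subseteq> f ` topspace T \<and> openin T {a \<in> topspace T. f a \<in> W})"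
    unfolding istopology_def
  proof (intro conjI allI impI)
    fix A B
    assume "A \<subseteq> f ` topspace T \<and> openin T {a \<in> topspace T. f a \<in> A}"
      and "B \<subseteq> f ` topspace T \<and> openin T {a \<in> topspace T. f a \<in> B}"
    moreover have "{a \<in> topspace T. f a \<in> A \<inter> B}
        = {a \<in> topspace T. f a \<in> A} \<inter> {a \<in> topspace T. f a \<in> B}"
      by auto
    ultimately show "A \<inter> B \<subseteq> f ` topspace T" "openin T {a \<in> topspace T. f a \<in> A \<inter> B}"
      by auto
  next
    fix \<K> assume K: "\<forall>K\<in>\<K>. K \<subseteq> f ` topspace T \<and> openin T {a \<in> topspace T. f a \<in> K}"
    have "{a \<in> topspace T. f a \<in> \<Union>\<K>} = (\<Union>K\<in>\<K>. {a \<in> topspace T. f a \<in> K})"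
      by auto
    then show "openin T {a \<in> topspace T. f a \<in> \<Union>\<K>}" and "\<Union>\<K> \<subseteq> f ` topspace T"
      using K by auto
  qed
  then show ?thesis
    by (simp add: quotient_topology_def)
qed

lemma quotient_map_quotient_topology: "quotient_map T (quotient_topology T f) f"
proof -
  have "topspace (quotient_topology T f) = f ` topspace T"
  proof
    have "{a \<in> topspace T. f a \<in> f ` topspace T} = topspace T"
      by auto
    then have "openin (quotient_topology T f) (f ` topspace T)"
      unfolding openin_quotient_topology by simp
    then show "f ` topspace T \<subseteq> topspace (quotient_topology T f)"
      by (rule openin_subset)
  next
    show "topspace (quotient_topology T f) \<subseteq> f ` topspace T"
      using openin_topspace[of "quotient_topology T f"] unfolding openin_quotient_topology by simp
  qed
  then show ?thesis
    by (simp add: quotient_map_def openin_quotient_topology)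
qed

definition pi1_qtop :: "'a::topological_space set \<Rightarrow> 'a \<Rightarrow> (real \<Rightarrow> 'a) set topology" where
  "pi1_qtop X x = quotient_topology (loop_space X x) (path_class X)"

lemma topspace_pi1_qtop: "topspace (pi1_qtop X x) = carrier (pi1 X x)"
proof -
  have "path_class X p \<in> path_class X ` (loops_at X x \<inter> extensional {0..1})"
    if p: "p \<in> loops_at X x" for p
  proof (rule image_eqI)
    have h: "homotopic_paths X p (restrict p {0..1})"
      using p by (intro homotopic_paths_eq) (auto simp: loops_at_def)
    then show "path_class X p = path_class X (restrict p {0..1})"
      by (rule path_class_eqI)
    show "restrict p {0..1} \<in> loops_at X x \<inter> extensional {0..1}"
      using p homotopic_paths_imp_path[OF h] homotopic_paths_imp_subset[OF h]
        homotopic_paths_imp_pathstart[OF h] homotopic_paths_imp_pathfinish[OF h]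
      by (simp add: loops_at_def)
  qed
  moreover have "topspace (pi1_qtop X x) = path_class X ` topspace (loop_space X x)"
    unfolding pi1_qtop_def by (simp add: quotient_imp_surjective_map[OF quotient_map_quotient_topology])
  ultimately show ?thesis
    by (auto simp: topspace_loop_space pi1_def)
qed


section \<open>The finest group topology\<close>

definition topological_group :: "('g, 'm) monoid_scheme \<Rightarrow> 'g topology \<Rightarrow> bool" where
  "topological_group G T \<longleftrightarrow>
     group G \<and> topspace T = carrier G \<and>
     continuous_map (prod_topology T T) T (\<lambda>(a, b). a \<otimes>\<^bsub>G\<^esub> b) \<and>
     continuous_map T T (\<lambda>a. inv\<^bsub>G\<^esub> a)"

definition coarser :: "'a topology \<Rightarrow> 'a topology \<Rightarrow> bool" where
  "coarser T U \<longleftrightarrow> topspace T = topspace U \<and> (\<forall>W. openin T W \<longrightarrow> openin U W)"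

text \<open>The description is proper by \<open>ex1_finest_group_topology\<close>. Coarser is not strict, and
  topological groups need not be Hausdorff.\<close>

definition finest_group_topology :: "('g, 'm) monoid_scheme \<Rightarrow> 'g topology \<Rightarrow> 'g topology" where
  "finest_group_topology G Q =
     (THE T. (topological_group G T \<and> coarser T Q) \<and>
             (\<forall>T'. topological_group G T' \<and> coarser T' Q \<longrightarrow> coarser T' T))"

lemma ex1_finest_group_topology:
  assumes G: "group G" and Q: "topspace Q = carrier G"
  shows "\<exists>!T. (topological_group G T \<and> coarser T Q) \<and>
              (\<forall>T'. topological_group G T' \<and> coarser T' Q \<longrightarrow> coarser T' T)"
proof (rule ex_ex1I)
  define \<T> where "\<T> = {T. topological_group G T \<and> coarser T Q}"
  define \<S> where "\<S> = insert (carrier G) (\<Union>T\<in>\<T>. {W. openin T W})"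
  define J where "J = topology_generated_by \<S>"
  have tops: "topspace T = carrier G" if "T \<in> \<T>" for T
    using that by (simp add: \<T>_def topological_group_def)
  have topJ: "topspace J = carrier G"
    unfolding J_def topology_generated_by_topspace \<S>_def using tops openin_subset by fastforce
  have below_J: "openin J W" if "T \<in> \<T>" "openin T W" for T W
    unfolding J_def using that by (intro topology_generated_by_Basis) (auto simp: \<S>_def)
  have "coarser T J" if "T \<in> \<T>" for T
    using that tops topJ below_J by (auto simp: coarser_def)
  moreover have "coarser J Q"
  proof -
    have "openin Q W" if "generate_topology_on \<S> W" for W
      using that
    proof (induction rule: generate_topology_on.induct)
      case (Basis W)
      then show ?case
        using Q openin_topspace[of Q] by (auto simp: \<S>_def \<T>_def coarser_def)
    qed auto
    then show ?thesis
      using topJ Q by (simp add: coarser_def J_def openin_topology_generated_by_iff)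
  qed
  moreover have "topological_group G J"
    unfolding topological_group_def
  proof (intro conjI)
    have id: "continuous_map J T (\<lambda>a. a)" if "T \<in> \<T>" for T
      unfolding continuous_map_def
    proof (intro conjI allI impI)
      show "(\<lambda>a. a) \<in> topspace J \<rightarrow> topspace T"
        using tops[OF that] topJ by simp
      fix W assume W: "openin T W"
      then have "{a \<in> topspace J. a \<in> W} = W"
        using openin_subset[OF W] tops[OF that] topJ by auto
      then show "openin J {a \<in> topspace J. a \<in> W}"
        using below_J[OF that W] by simp
    qed
    have id2: "continuous_map (prod_topology J J) (prod_topology T T) (\<lambda>z. z)" if "T \<in> \<T>" for T
      using continuous_map_prod_top[of J J T T "\<lambda>a. a" "\<lambda>a. a"] id[OF that] by (simp add: id_def)
    have mult_T: "continuous_map (prod_topology J J) T (\<lambda>(a, b). a \<otimes>\<^bsub>G\<^esub> b)" if "T \<in> \<T>" for T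
      using continuous_map_compose[OF id2[OF that], of T "\<lambda>(a, b). a \<otimes>\<^bsub>G\<^esub> b"] that
      by (simp add: \<T>_def topological_group_def comp_def)
    have inv_T: "continuous_map J T (\<lambda>a. inv\<^bsub>G\<^esub> a)" if "T \<in> \<T>" for T
      using continuous_map_compose[OF id[OF that], of T "\<lambda>a. inv\<^bsub>G\<^esub> a"] that
      by (simp add: \<T>_def topological_group_def comp_def)
    have UnS: "\<Union>\<S> = carrier G"
      using topJ by (simp add: J_def)
    have continuous_on_J: "continuous_map Y J f \<longleftrightarrow>
        (\<forall>W\<in>\<S>. openin Y (f -` W \<inter> topspace Y)) \<and> f ` topspace Y \<subseteq> \<Union>\<S>"
      for Y :: "'c topology" and f
      unfolding J_def continuous_on_generated_topo_iff by auto
    show "continuous_map (prod_topology J J) J (\<lambda>(a, b). a \<otimes>\<^bsub>G\<^esub> b)"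
      unfolding continuous_on_J
    proof (intro conjI ballI)
      show *: "(\<lambda>(a, b). a \<otimes>\<^bsub>G\<^esub> b) ` topspace (prod_topology J J) \<subseteq> \<Union>\<S>"
        using topJ UnS G by (auto simp: group.is_monoid monoid.m_closed)
      fix W assume "W \<in> \<S>"
      then consider "W = carrier G" | T where "T \<in> \<T>" "openin T W"
        by (auto simp: \<S>_def)
      then show "openin (prod_topology J J)
          ((\<lambda>(a, b). a \<otimes>\<^bsub>G\<^esub> b) -` W \<inter> topspace (prod_topology J J))"
      proof cases
        case 1
        then show ?thesis
          using * UnS by (simp add: image_subset_iff_subset_vimage Int_absorb1 openin_topspace del: topspace_prod_topology)
      next
        case 2
        then show ?thesis
          using mult_T[OF 2(1)] by (simp add: continuous_map_alt del: topspace_prod_topology)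
      qed
    qed
    show "continuous_map J J (\<lambda>a. inv\<^bsub>G\<^esub> a)"
      unfolding continuous_on_J
    proof (intro conjI ballI)
      show *: "(\<lambda>a. inv\<^bsub>G\<^esub> a) ` topspace J \<subseteq> \<Union>\<S>"
        using topJ UnS G by (auto simp: group.inv_closed)
      fix W assume "W \<in> \<S>"
      then consider "W = carrier G" | T where "T \<in> \<T>" "openin T W"
        by (auto simp: \<S>_def)
      then show "openin J ((\<lambda>a. inv\<^bsub>G\<^esub> a) -` W \<inter> topspace J)"
      proof cases
        case 1
        then show ?thesis
          using * UnS by (simp add: image_subset_iff_subset_vimage Int_absorb1 openin_topspace del: topspace_prod_topology)
      next
        case 2
        then show ?thesis
          using inv_T[OF 2(1)] by (simp add: continuous_map_alt)
      qed
    qed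
  qed (use G topJ in auto)
  ultimately show "\<exists>T. (topological_group G T \<and> coarser T Q) \<and>
              (\<forall>T'. topological_group G T' \<and> coarser T' Q \<longrightarrow> coarser T' T)"
    unfolding \<T>_def by blast
next
  fix T T'
  assume "(topological_group G T \<and> coarser T Q) \<and>
          (\<forall>T'. topological_group G T' \<and> coarser T' Q \<longrightarrow> coarser T' T)"
    and "(topological_group G T' \<and> coarser T' Q) \<and>
          (\<forall>T''. topological_group G T'' \<and> coarser T'' Q \<longrightarrow> coarser T'' T')"
  then have "coarser T T'" "coarser T' T"
    by simp_all
  then show "T = T'"
    unfolding topology_eq coarser_def by simp metis
qed

definition pi1_tau :: "'a::topological_space set \<Rightarrow> 'a \<Rightarrow> (real \<Rightarrow> 'a) set topology" where
  "pi1_tau X x = finest_group_topology (pi1 X x) (pi1_qtop X x)"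

lemma pi1_tau:
  assumes "x \<in> X"
  shows "topological_group (pi1 X x) (pi1_tau X x)"
    and "coarser (pi1_tau X x) (pi1_qtop X x)"
    and "topological_group (pi1 X x) T \<Longrightarrow> coarser T (pi1_qtop X x) \<Longrightarrow> coarser T (pi1_tau X x)"
  using theI'[OF ex1_finest_group_topology[OF group_pi1[OF assms] topspace_pi1_qtop]]
  unfolding pi1_tau_def finest_group_topology_def by blast+

definition indiscrete :: "'a topology \<Rightarrow> bool" where
  "indiscrete T \<longleftrightarrow> (\<forall>W. openin T W \<longleftrightarrow> W = {} \<or> W = topspace T)"


section \<open>Spanier groups and Spanier spaces\<close>

definition open_cover :: "'a::topological_space set \<Rightarrow> 'a set set \<Rightarrow> bool" where
  "open_cover X \<U> \<longleftrightarrow> (\<forall>U\<in>\<U>. openin (top_of_set X) U) \<and> \<Union>\<U> = X"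

definition lasso_pair :: "'a::topological_space set \<Rightarrow> 'a set set \<Rightarrow> 'a \<Rightarrow>
    (real \<Rightarrow> 'a) \<times> (real \<Rightarrow> 'a) \<Rightarrow> bool" where
  "lasso_pair X \<U> x = (\<lambda>(u, v).
     path u \<and> path_image u \<subseteq> X \<and> pathstart u = x \<and>
     (\<exists>U\<in>\<U>. v \<in> loops_at U (pathfinish u)))"

text \<open>The empty product is the constant loop, which also arises from a single lasso with
  both \<open>u\<close> and \<open>v\<close> constant.\<close>

definition lasso_product :: "'a::topological_space \<Rightarrow> ((real \<Rightarrow> 'a) \<times> (real \<Rightarrow> 'a)) list \<Rightarrow>
    real \<Rightarrow> 'a" where
  "lasso_product x uvs = foldr (\<lambda>(u, v) r. (u +++ v +++ reversepath u) +++ r) uvs (\<lambda>_. x)"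

definition spanier_group_cover :: "'a::topological_space set \<Rightarrow> 'a set set \<Rightarrow> 'a \<Rightarrow>
    (real \<Rightarrow> 'a) set set" where
  "spanier_group_cover X \<U> x =
     {path_class X (lasso_product x uvs) | uvs. \<forall>uv\<in>set uvs. lasso_pair X \<U> x uv}"

definition spanier_group :: "'a::topological_space set \<Rightarrow> 'a \<Rightarrow> (real \<Rightarrow> 'a) set set" where
  "spanier_group X x = (\<Inter>\<U>\<in>{\<U>. open_cover X \<U>}. spanier_group_cover X \<U> x)"

definition spanier_space :: "'a::topological_space set \<Rightarrow> bool" where
  "spanier_space X \<longleftrightarrow> (\<forall>y\<in>X. carrier (pi1 X y) = spanier_group X y)"

end

theory Submission
  imports Defs
begin

text \<open>Fix an open cover. Identifying any two paths that have the same end points and lie in a common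
  member of the cover generates a congruence on the fundamental groupoid, and a loop congruent to a
  constant is homotopic to a lasso product. By local path connectedness, a loop is congruent to all
  loops near it in the compact-open topology. Hence the sets of classes saturated under the
  congruence are the open sets of a group topology coarser than the quotient topology, and so
  coarser than the finest such topology; if the latter is indiscrete, all loops at \<open>x\<close> are
  congruent to the constant loop. Conjugation by a path carries this over to every other base
  point.\<close>


section \<open>Multiplication of path classes\<close>

definition path_in :: "'a::topological_space set \<Rightarrow> (real \<Rightarrow> 'a) \<Rightarrow> bool" where
  "path_in X p \<longleftrightarrow> path p \<and> path_image p \<subseteq> X"

text \<open>The end point condition makes associativity unconditional, so that it can be
  a rewrite rule.\<close>

definition path_mult :: "'a::topological_space set \<Rightarrow> (real \<Rightarrow> 'a) set \<Rightarrow> (real \<Rightarrow> 'a) set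
    \<Rightarrow> (real \<Rightarrow> 'a) set" where
  "path_mult X A B = {r. \<exists>p\<in>A. \<exists>q\<in>B. path_in X p \<and> path_in X q \<and> pathfinish p = pathstart q
                          \<and> homotopic_paths X r (p +++ q)}"

lemma path_in_join [simp]:
  "pathfinish p = pathstart q \<Longrightarrow> path_in X (p +++ q) \<longleftrightarrow> path_in X p \<and> path_in X q"
  by (auto simp: path_in_def path_image_join)

lemma path_in_reversepath [simp]: "path_in X (reversepath p) \<longleftrightarrow> path_in X p"
  by (simp add: path_in_def)

lemma path_in_const [simp]: "path_in X (\<lambda>_. a) \<longleftrightarrow> a \<in> X"
  by (auto simp: path_in_def path_def path_image_def)

lemma path_in_mono: "path_in X p \<Longrightarrow> X \<subseteq> Y \<Longrightarrow> path_in Y p"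
  by (auto simp: path_in_def)

lemma pathstart_const [simp]: "pathstart (\<lambda>_. a) = a"
  and pathfinish_const [simp]: "pathfinish (\<lambda>_. a) = a"
  by (simp_all add: pathstart_def pathfinish_def)

lemma path_in_ends_in: "path_in X p \<Longrightarrow> pathstart p \<in> X" "path_in X p \<Longrightarrow> pathfinish p \<in> X"
  unfolding path_in_def using pathstart_in_path_image pathfinish_in_path_image by blast+

lemma loops_at_iff_path_in: "p \<in> loops_at X x \<longleftrightarrow> path_in X p \<and> pathstart p = x \<and> pathfinish p = x"
  by (auto simp: loops_at_def path_in_def)

lemma homotopic_paths_imp:
  assumes "homotopic_paths X p q"
  shows "path_in X p" "path_in X q" "pathstart q = pathstart p" "pathfinish q = pathfinish p"
  using homotopic_paths_imp_path[OF assms] homotopic_paths_imp_subset[OF assms]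
    homotopic_paths_imp_pathstart[OF assms] homotopic_paths_imp_pathfinish[OF assms]
  by (auto simp: path_in_def)

lemma path_class_eq_iff: "path_in X p \<Longrightarrow> path_class X p = path_class X q \<longleftrightarrow> homotopic_paths X p q"
  using path_class_eqI[of X p q]
  by (auto simp: path_class_def path_in_def set_eq_iff intro: homotopic_paths_sym)

lemma path_class_self: "path_in X p \<Longrightarrow> p \<in> path_class X p"
  by (simp add: path_class_def path_in_def)

lemma reversepath_const [simp]: "reversepath (\<lambda>_. a) = (\<lambda>_. a)"
  by (simp add: reversepath_def)

lemma path_multI:
  "p \<in> A \<Longrightarrow> q \<in> B \<Longrightarrow> path_in X p \<Longrightarrow> path_in X q \<Longrightarrow> pathfinish p = pathstart q \<Longrightarrow>
     homotopic_paths X r (p +++ q) \<Longrightarrow> r \<in> path_mult X A B"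
  unfolding path_mult_def by blast

text \<open>Homotopies fix end points, so both bracketings force the same matching conditions on the
  three representatives; for matching paths, joining is associative up to homotopy. If nothing
  matches, both sides are empty.\<close>

lemma path_mult_assoc [simp]:
  "path_mult X (path_mult X A B) C = path_mult X A (path_mult X B C)"
proof (intro equalityI subsetI)
  fix r assume "r \<in> path_mult X (path_mult X A B) C"
  then obtain s c p q where *: "c \<in> C" "path_in X c" "pathfinish s = pathstart c"
      "homotopic_paths X r (s +++ c)" "p \<in> A" "q \<in> B" "path_in X p" "path_in X q"
      "pathfinish p = pathstart q" "homotopic_paths X s (p +++ q)"
    unfolding path_mult_def by blast
  have qc: "pathfinish q = pathstart c"
    using * homotopic_paths_imp(4)[OF *(10)] by simp
  have "homotopic_paths X (s +++ c) ((p +++ q) +++ c)"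
    using * by (intro homotopic_paths_join) (auto simp: path_in_def)
  moreover have "homotopic_paths X ((p +++ q) +++ c) (p +++ q +++ c)"
    using * qc by (intro homotopic_paths_sym[OF homotopic_paths_assoc]) (auto simp: path_in_def)
  ultimately have "homotopic_paths X r (p +++ q +++ c)"
    using *(4) homotopic_paths_trans by blast
  moreover have "q +++ c \<in> path_mult X B C"
    using * qc by (intro path_multI[of q _ c]) (auto simp: path_in_def path_image_join)
  ultimately show "r \<in> path_mult X A (path_mult X B C)"
    using * qc by (intro path_multI[of p A "q +++ c"]) auto
next
  fix r assume "r \<in> path_mult X A (path_mult X B C)"
  then obtain s c p q where *: "p \<in> A" "path_in X p" "pathfinish p = pathstart s"
      "homotopic_paths X r (p +++ s)" "q \<in> B" "c \<in> C" "path_in X q" "path_in X c"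
      "pathfinish q = pathstart c" "homotopic_paths X s (q +++ c)"
    unfolding path_mult_def by blast
  have pq: "pathfinish p = pathstart q"
    using * homotopic_paths_imp(3)[OF *(10)] by simp
  have "homotopic_paths X (p +++ s) (p +++ q +++ c)"
    using * by (intro homotopic_paths_join) (auto simp: path_in_def)
  moreover have "homotopic_paths X (p +++ q +++ c) ((p +++ q) +++ c)"
    using * pq by (intro homotopic_paths_assoc) (auto simp: path_in_def)
  ultimately have "homotopic_paths X r ((p +++ q) +++ c)"
    using *(4) homotopic_paths_trans by blast
  moreover have "p +++ q \<in> path_mult X A B"
    using * pq by (intro path_multI[of p _ q]) (auto simp: path_in_def path_image_join)
  ultimately show "r \<in> path_mult X (path_mult X A B) C"
    using * pq by (intro path_multI[of "p +++ q" _ c C]) auto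
qed

text \<open>Joining respects homotopy in both factors. Classes of iterated joins thereby become
  products of classes, and homotopies between them can be found by rewriting.\<close>

lemma path_class_join:
  assumes "path_in X p" "path_in X q" "pathfinish p = pathstart q"
  shows "path_class X (p +++ q) = path_mult X (path_class X p) (path_class X q)"
proof (intro equalityI subsetI)
  fix r assume "r \<in> path_class X (p +++ q)"
  then show "r \<in> path_mult X (path_class X p) (path_class X q)"
    using assms
    by (intro path_multI[of p _ q] path_class_self) (auto simp: path_class_def intro: homotopic_paths_sym)
next
  fix r assume "r \<in> path_mult X (path_class X p) (path_class X q)"
  then obtain p' q' where *: "homotopic_paths X p p'" "homotopic_paths X q q'"
      "homotopic_paths X r (p' +++ q')"
    unfolding path_mult_def path_class_def by blast
  then show "r \<in> path_class X (p +++ q)"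
    using homotopic_paths_join[OF *(1,2) assms(3)]
    by (auto simp: path_class_def intro: homotopic_paths_trans homotopic_paths_sym)
qed

text \<open>The unit and inverse laws are the instances of this identity with \<open>s, t, r \<in> {0, 1}\<close>.\<close>

lemma homotopic_paths_join_segments:
  assumes "path_in X p" "s \<in> {0..1}" "t \<in> {0..1}" "r \<in> {0..1}"
  shows "homotopic_paths X ((p \<circ> linepath s t) +++ (p \<circ> linepath t r)) (p \<circ> linepath s r)"
proof -
  have conv: "closed_segment a b \<subseteq> {0..1}" if "a \<in> {0..1}" "b \<in> {0..1}" for a b :: real
    using that by (simp add: closed_segment_subset)
  have "path_image (linepath s t +++ linepath t r) \<subseteq> {0..1}" "path_image (linepath s r) \<subseteq> {0..1}"
    using conv assms by (auto simp: path_image_join)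
  then have "(linepath s t +++ linepath t r) x \<in> {0..1}" "linepath s r x \<in> {0..1}"
      if "x \<in> {0..1}" for x
    using that unfolding path_image_def by blast+
  \<comment> \<open>Both paths run from \<open>s\<close> to \<open>r\<close> inside the convex set
    \<open>{0..1}\<close>, so a straight-line homotopy joins them; composing with \<open>p\<close>
    carries it into \<open>X\<close>.\<close>
  then have "homotopic_paths {0..1} (linepath s t +++ linepath t r) (linepath s r)"
    by (intro homotopic_paths_linear conv) simp_all
  moreover have "continuous_on {0..1} p" "p \<in> {0..1} \<rightarrow> X"
    using assms(1) by (auto simp: path_in_def path_def path_image_def)
  ultimately have "homotopic_paths X (p \<circ> (linepath s t +++ linepath t r)) (p \<circ> linepath s r)"
    by (rule homotopic_paths_continuous_image)
  then show ?thesis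
    by (simp add: path_compose_join)
qed

lemma compose_linepath_unit:
  fixes p :: "real \<Rightarrow> 'a::topological_space"
  shows "p \<circ> linepath 0 1 = p" "p \<circ> linepath 1 0 = reversepath p"
    "p \<circ> linepath 0 0 = (\<lambda>_. pathstart p)" "p \<circ> linepath 1 1 = (\<lambda>_. pathfinish p)"
  by (auto simp: fun_eq_iff linepath_def reversepath_def pathstart_def pathfinish_def)

lemma path_mult_const_left:
  "path_in X p \<Longrightarrow> a = pathstart p \<Longrightarrow>
     path_mult X (path_class X (\<lambda>_. a)) (path_class X p) = path_class X p"
  using homotopic_paths_join_segments[of X p 0 0 1, THEN path_class_eqI]
  by (simp add: compose_linepath_unit path_class_join path_in_ends_in)

lemma path_mult_const_right:
  "path_in X p \<Longrightarrow> a = pathfinish p \<Longrightarrow>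
     path_mult X (path_class X p) (path_class X (\<lambda>_. a)) = path_class X p"
  using homotopic_paths_join_segments[of X p 0 1 1, THEN path_class_eqI]
  by (simp add: compose_linepath_unit path_class_join path_in_ends_in)

lemma path_mult_reversepath_right:
  "path_in X p \<Longrightarrow>
     path_mult X (path_class X p) (path_class X (reversepath p)) = path_class X (\<lambda>_. pathstart p)"
  using homotopic_paths_join_segments[of X p 0 1 0, THEN path_class_eqI]
  by (simp add: compose_linepath_unit path_class_join)

lemma path_mult_reversepath_left:
  "path_in X p \<Longrightarrow>
     path_mult X (path_class X (reversepath p)) (path_class X p) = path_class X (\<lambda>_. pathfinish p)"
  using path_mult_reversepath_right[of X "reversepath p"] by simp

lemmas path_mult_laws =
  path_mult_const_left path_mult_const_right path_mult_reversepath_left path_mult_reversepath_right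

text \<open>Together with associativity, these rules decide identities between products of paths.\<close>

lemma path_mult_cancel:
  "path_in X p \<Longrightarrow> a = pathstart p \<Longrightarrow>
     path_mult X (path_class X (\<lambda>_. a)) (path_mult X (path_class X p) C) = path_mult X (path_class X p) C"
  "path_in X p \<Longrightarrow> a = pathfinish p \<Longrightarrow>
     path_mult X (path_class X p) (path_mult X (path_class X (\<lambda>_. a)) C) = path_mult X (path_class X p) C"
  "path_in X p \<Longrightarrow> path_mult X (path_class X (reversepath p)) (path_mult X (path_class X p) C) =
     path_mult X (path_class X (\<lambda>_. pathfinish p)) C"
  "path_in X p \<Longrightarrow> path_mult X (path_class X p) (path_mult X (path_class X (reversepath p)) C) =
     path_mult X (path_class X (\<lambda>_. pathstart p)) C"
  by (simp_all add: path_mult_laws flip: path_mult_assoc)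

lemmas path_class_simps =
  path_class_join path_mult_laws path_mult_cancel reversepath_joinpaths path_in_ends_in


section \<open>Products of lassos\<close>

lemma lasso_pair_iff:
  "lasso_pair X \<U> x (u, v) \<longleftrightarrow> path_in X u \<and> pathstart u = x \<and>
     (\<exists>U\<in>\<U>. path_in U v) \<and> pathstart v = pathfinish u \<and> pathfinish v = pathfinish u"
  by (auto simp: lasso_pair_def loops_at_iff_path_in path_in_def)

lemma lasso_pairD:
  assumes "lasso_pair X \<U> x (u, v)" "\<Union>\<U> \<subseteq> X"
  shows "path_in X u" "path_in X v" "pathstart u = x" "pathstart v = pathfinish u"
    "pathfinish v = pathfinish u"
  using assms by (auto simp: lasso_pair_iff intro: path_in_mono)

lemma lasso_product_Nil [simp]: "lasso_product x [] = (\<lambda>_. x)"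
  and lasso_product_Cons [simp]:
    "lasso_product x ((u, v) # uvs) = (u +++ v +++ reversepath u) +++ lasso_product x uvs"
  by (simp_all add: lasso_product_def)

lemma lasso_product_in_loops_at:
  assumes "\<forall>uv\<in>set uvs. lasso_pair X \<U> x uv" "\<Union>\<U> \<subseteq> X" "x \<in> X"
  shows "lasso_product x uvs \<in> loops_at X x"
  using assms(1)
proof (induction uvs)
  case (Cons uv uvs)
  then show ?case
    using lasso_pairD[of X \<U> x "fst uv" "snd uv"] assms(2)
    by (cases uv) (auto simp: loops_at_iff_path_in)
qed (use assms in \<open>auto simp: loops_at_iff_path_in\<close>)

text \<open>Each induction step is associativity of \<open>path_mult\<close>. It follows that
  classes of lasso products at \<open>x\<close> are closed under multiplication.\<close>

lemma path_class_lasso_product_append: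
  assumes "\<forall>uv\<in>set (uvs @ uvs'). lasso_pair X \<U> x uv" "\<Union>\<U> \<subseteq> X" "x \<in> X"
  shows "path_class X (lasso_product x (uvs @ uvs'))
    = path_mult X (path_class X (lasso_product x uvs)) (path_class X (lasso_product x uvs'))"
  using assms(1)
proof (induction uvs)
  case Nil
  then show ?case
    using lasso_product_in_loops_at[of uvs' X \<U> x] assms
    by (simp add: loops_at_iff_path_in path_class_simps)
next
  case (Cons uv uvs)
  obtain u v where uv: "uv = (u, v)"
    by (cases uv)
  have "lasso_product x uvs \<in> loops_at X x" "lasso_product x (uvs @ uvs') \<in> loops_at X x"
    using Cons.prems by (intro lasso_product_in_loops_at[where \<U> = \<U>] assms; simp)+
  moreover have "lasso_pair X \<U> x (u, v)"
    using Cons.prems uv by simp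
  note lasso_pairD[OF this assms(2)]
  ultimately show ?case
    using Cons by (simp add: uv loops_at_iff_path_in path_class_simps)
qed

text \<open>A path \<open>r\<close> moves past a single lasso by extending its tail: up to homotopy,
  \<open>r\<close> followed by the lasso on \<open>u\<close> is the lasso on \<open>r +++ u\<close>
  followed by \<open>r\<close>. This transports lassos from the end of \<open>r\<close> to its
  start.\<close>

lemma path_class_lasso_product_conjugate:
  assumes "\<forall>uv\<in>set uvs. lasso_pair X \<U> x uv" "\<Union>\<U> \<subseteq> X"
    and r: "path_in X r" "pathfinish r = x"
  shows "path_mult X (path_class X r) (path_class X (lasso_product x uvs))
    = path_mult X (path_class X (lasso_product (pathstart r) (map (\<lambda>(u, v). (r +++ u, v)) uvs)))
        (path_class X r)"
  using assms(1)
proof (induction uvs)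
  case Nil
  then show ?case
    using r by (simp add: path_class_simps)
next
  case (Cons uv uvs)
  obtain u v where uv: "uv = (u, v)"
    by (cases uv)
  define uvs' where "uvs' = map (\<lambda>(u, v). (r +++ u, v)) uvs"
  have "x \<in> X"
    using r path_in_ends_in by blast
  have "lasso_pair X \<U> (pathstart r) uv'" if "uv' \<in> set uvs'" for uv'
    using that Cons.prems r by (auto simp: uvs'_def lasso_pair_iff)
  then have "lasso_product x uvs \<in> loops_at X x"
     "lasso_product (pathstart r) uvs' \<in> loops_at X (pathstart r)"
    using Cons.prems r \<open>x \<in> X\<close>
    by (intro lasso_product_in_loops_at[where \<U> = \<U>] assms path_in_ends_in; simp)+
  moreover have "lasso_pair X \<U> x (u, v)"
    using Cons.prems uv by simp
  note lasso_pairD[OF this assms(2)]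
  ultimately show ?case
    \<comment> \<open>Read backwards, the induction hypothesis brings \<open>r\<close> to the left
      of the remaining lassos, next to its reverse from the first extended lasso, and the two
      cancel.\<close>
    using r Cons.IH[symmetric] Cons.prems
    by (simp add: uv loops_at_iff_path_in path_class_simps flip: uvs'_def)
qed


section \<open>The congruence on paths generated by an open cover\<close>

text \<open>Reflexivity on paths in \<open>X\<close> and symmetry are not imposed, since both follow
  from these rules. In \<open>join\<close> it is enough that \<open>p\<close> and \<open>p'\<close>
  match, because congruent paths share their end points.\<close>

inductive cover_cong :: "'a::topological_space set \<Rightarrow> 'a set set \<Rightarrow> (real \<Rightarrow> 'a) \<Rightarrow> (real \<Rightarrow> 'a) \<Rightarrow> bool"
  for X \<U> where
  homotopic: "homotopic_paths X p q \<Longrightarrow> cover_cong X \<U> p q"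
| small: "U \<in> \<U> \<Longrightarrow> path_in U p \<Longrightarrow> path_in U q \<Longrightarrow> pathstart p = pathstart q \<Longrightarrow>
    pathfinish p = pathfinish q \<Longrightarrow> cover_cong X \<U> p q"
| join: "cover_cong X \<U> p q \<Longrightarrow> cover_cong X \<U> p' q' \<Longrightarrow> pathfinish p = pathstart p' \<Longrightarrow>
    cover_cong X \<U> (p +++ p') (q +++ q')"
| trans: "cover_cong X \<U> p q \<Longrightarrow> cover_cong X \<U> q r \<Longrightarrow> cover_cong X \<U> p r"

lemma cover_cong_refl: "path_in X p \<Longrightarrow> cover_cong X \<U> p p"
  by (rule cover_cong.homotopic) (simp add: path_in_def)

lemma cover_cong_ends:
  assumes "cover_cong X \<U> p q"
  shows "pathstart p = pathstart q \<and> pathfinish p = pathfinish q"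
  using assms by induction (auto dest: homotopic_paths_imp)

lemma cover_cong_path_in:
  assumes "cover_cong X \<U> p q" "\<Union>\<U> \<subseteq> X"
  shows "path_in X p \<and> path_in X q"
  using assms
proof induction
  case (small U p q)
  then show ?case
    by (meson Union_upper order_trans path_in_mono)
next
  case (join p q p' q')
  then show ?case
    using cover_cong_ends[OF join(1)] cover_cong_ends[OF join(2)] by simp
qed (auto dest: homotopic_paths_imp)

lemma cover_cong_sym: "cover_cong X \<U> p q \<Longrightarrow> cover_cong X \<U> q p"
proof (induction rule: cover_cong.induct)
  case (join p q p' q')
  then show ?case
    using cover_cong_ends[OF join(1)] cover_cong_ends[OF join(2)] by (intro cover_cong.join) auto
qed (auto intro: cover_cong.intros homotopic_paths_sym)

text \<open>Turns an identity between products of classes, which rewriting can decide, into a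
  congruence of paths.\<close>

lemma cover_cong_class:
  assumes "path_class X p = path_class X q" "path_in X p"
  shows "cover_cong X \<U> p q"
  using assms by (auto simp: path_class_eq_iff intro: cover_cong.homotopic)

text \<open>Induction over the generation of the congruence. Transitivity concatenates the lists of
  lassos; for joins, the lassos of the second factor are first transported to the start of the first
  one.\<close>

lemma cover_cong_imp_lasso_product:
  assumes "cover_cong X \<U> p q" "\<Union>\<U> \<subseteq> X"
  shows "\<exists>uvs. (\<forall>uv\<in>set uvs. lasso_pair X \<U> (pathstart p) uv) \<and>
    path_class X p = path_mult X (path_class X (lasso_product (pathstart p) uvs)) (path_class X q)"
  using assms
proof induction
  case (homotopic p q)
  then show ?case
    using homotopic_paths_imp[OF homotopic(1)] path_class_eqI[OF homotopic(1)]
    by (intro exI[of _ "[]"]) (auto simp: path_class_simps)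
next
  case (small U p q)
  have "path_in X p" "path_in X q"
    using small by (auto intro: path_in_mono)
  then show ?case
    using small
    \<comment> \<open>Since \<open>p\<close> and \<open>q\<close> share their end points and lie in
      \<open>U\<close>, following \<open>p\<close> and then \<open>q\<close> backwards is a loop in
      \<open>U\<close>: one lasso with a constant tail.\<close>
    by (intro exI[of _ "[(\<lambda>_. pathstart p, p +++ reversepath q)]"])
       (auto simp: lasso_pair_iff path_class_simps)
next
  case (join p q p' q')
  define x where "x = pathstart p"
  define y where "y = pathfinish p"
  obtain uvs uvs' where 1: "\<forall>uv\<in>set uvs. lasso_pair X \<U> x uv"
      "path_class X p = path_mult X (path_class X (lasso_product x uvs)) (path_class X q)"
    and 2: "\<forall>uv\<in>set uvs'. lasso_pair X \<U> y uv"
      "path_class X p' = path_mult X (path_class X (lasso_product y uvs')) (path_class X q')"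
    using join by (auto simp: x_def y_def)
  have *: "path_in X p" "path_in X q" "path_in X p'" "path_in X q'" "pathfinish p = pathstart p'"
      "pathstart q = x" "pathfinish q = y" "pathstart q' = y"
    using join cover_cong_path_in cover_cong_ends by (metis x_def y_def)+
  \<comment> \<open>The tails are extended by \<open>q\<close> and not by \<open>p\<close>: once
    \<open>p\<close> is replaced by its lassos followed by \<open>q\<close>, it is \<open>q\<close>
    that stands before the lassos of \<open>p'\<close>.\<close>
  define uvs'' where "uvs'' = map (\<lambda>(u, v). (q +++ u, v)) uvs'"
  have "x \<in> X"
    using * path_in_ends_in by blast
  have 3: "\<forall>uv\<in>set (uvs @ uvs''). lasso_pair X \<U> x uv"
    using 1 2 * by (auto simp: uvs''_def lasso_pair_iff)
  have "path_class X (p +++ p') = path_mult X (path_class X (lasso_product x uvs))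
      (path_mult X (path_class X q) (path_mult X (path_class X (lasso_product y uvs')) (path_class X q')))"
    using * 1 2 by (simp add: path_class_join)
  also have "\<dots> = path_mult X (path_class X (lasso_product x uvs))
      (path_mult X (path_mult X (path_class X q) (path_class X (lasso_product y uvs'))) (path_class X q'))"
    by simp
  also have "path_mult X (path_class X q) (path_class X (lasso_product y uvs'))
      = path_mult X (path_class X (lasso_product x uvs'')) (path_class X q)"
    using path_class_lasso_product_conjugate[OF 2(1) join.prems *(2,7)] *(6) by (simp add: uvs''_def)
  also have "path_mult X (path_class X (lasso_product x uvs))
      (path_mult X (path_mult X (path_class X (lasso_product x uvs'')) (path_class X q)) (path_class X q'))
      = path_mult X (path_class X (lasso_product x (uvs @ uvs''))) (path_class X (q +++ q'))"
    using path_class_lasso_product_append[OF 3 join.prems \<open>x \<in> X\<close>] * by (simp add: path_class_join)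
  finally show ?case
    using 3 unfolding x_def pathstart_join by blast
next
  case (trans p q r)
  define x where "x = pathstart p"
  have "pathstart q = x" "x \<in> X"
    using trans cover_cong_ends cover_cong_path_in path_in_ends_in by (metis x_def)+
  then obtain uvs uvs' where 1: "\<forall>uv\<in>set uvs. lasso_pair X \<U> x uv"
      "path_class X p = path_mult X (path_class X (lasso_product x uvs)) (path_class X q)"
    and 2: "\<forall>uv\<in>set uvs'. lasso_pair X \<U> x uv"
      "path_class X q = path_mult X (path_class X (lasso_product x uvs')) (path_class X r)"
    using trans by (auto simp: x_def)
  have 3: "\<forall>uv\<in>set (uvs @ uvs'). lasso_pair X \<U> x uv"
    using 1 2 by auto
  show ?case
    using path_class_lasso_product_append[OF 3 trans.prems \<open>x \<in> X\<close>] 1 2 3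
    by (intro exI[of _ "uvs @ uvs'"]) (simp add: x_def)
qed

text \<open>When the second path is constant, the factor left beside the lasso product is
  trivial.\<close>

lemma cover_cong_const_imp_spanier:
  assumes "cover_cong X \<U> p (\<lambda>_. x)" "\<Union>\<U> \<subseteq> X"
  shows "path_class X p \<in> spanier_group_cover X \<U> x"
proof -
  have x: "pathstart p = x" "x \<in> X"
    using cover_cong_ends[OF assms(1)] cover_cong_path_in[OF assms] by simp_all
  then obtain uvs where uvs: "\<forall>uv\<in>set uvs. lasso_pair X \<U> x uv"
      "path_class X p = path_mult X (path_class X (lasso_product x uvs)) (path_class X (\<lambda>_. x))"
    using cover_cong_imp_lasso_product[OF assms] by auto
  have "path_class X p = path_class X (lasso_product x uvs)"
    unfolding uvs(2) using lasso_product_in_loops_at[OF uvs(1) assms(2) x(2)]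
    by (intro path_mult_const_right) (auto simp: loops_at_iff_path_in)
  then show ?thesis
    using uvs(1) by (auto simp: spanier_group_cover_def)
qed


text \<open>The intersection over all open covers is contained in its term for the cover
  \<open>{X}\<close>, and lasso products for that cover are loops in \<open>X\<close>.\<close>

lemma spanier_group_subset_carrier:
  assumes "x \<in> X"
  shows "spanier_group X x \<subseteq> carrier (pi1 X x)"
proof -
  have "open_cover X {X}"
    by (simp add: open_cover_def)
  moreover have "spanier_group_cover X {X} x \<subseteq> carrier (pi1 X x)"
    using lasso_product_in_loops_at[of _ X "{X}" x] assms
    by (auto simp: spanier_group_cover_def pi1_def)
  ultimately show ?thesis
    unfolding spanier_group_def by blast
qed


section \<open>Congruence classes of loops are open\<close>

text \<open>These are the subbasic sets of the compact-open topology, cut down to the loops.\<close>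

lemma openin_loop_space:
  assumes "compact K" "K \<subseteq> {0..1}" "openin (top_of_set X) W"
  shows "openin (loop_space X x) {q \<in> topspace (loop_space X x). q ` K \<subseteq> W}"
  unfolding loop_space_def openin_subtopology
proof (intro exI conjI)
  let ?T = "{q \<in> extensional {0..1}. continuous_map (top_of_set {0..1}) (top_of_set X) q \<and> q ` K \<subseteq> W}"
  show "openin (compact_open_topology (top_of_set {0..1::real}) (top_of_set X)) ?T"
    unfolding compact_open_topology_def using assms
    by (intro topology_generated_by_Basis) (auto simp: compactin_subtopology)
  show "{q \<in> topspace (subtopology (compact_open_topology (top_of_set {0..1}) (top_of_set X))
            (loops_at X x)). q ` K \<subseteq> W} = ?T \<inter> loops_at X x"
    by (auto simp: topspace_compact_open_topology)
qed

text \<open>The congruence is required for all short connecting paths between the end points of \<open>p\<close> and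
  those of a nearby loop \<open>q\<close>, so that adjacent segments can be glued along a common such path.\<close>

definition cong_nearby :: "'a::topological_space set \<Rightarrow> 'a set set \<Rightarrow> (real \<Rightarrow> 'a) \<Rightarrow> real \<Rightarrow> real
    \<Rightarrow> 'a set \<Rightarrow> 'a set \<Rightarrow> (real \<Rightarrow> 'a) set \<Rightarrow> bool" where
  "cong_nearby X \<U> p s t A B N \<longleftrightarrow>
     (\<forall>q\<in>N. \<forall>g h. path_in A g \<and> pathstart g = p s \<and> pathfinish g = q s \<and>
        path_in B h \<and> pathstart h = p t \<and> pathfinish h = q t \<longrightarrow>
        cover_cong X \<U> ((p \<circ> linepath s t) +++ h) (g +++ (q \<circ> linepath s t)))"

lemma cong_nearbyD:
  assumes "cong_nearby X \<U> p s t A B N" "q \<in> N"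
    and "path_in A g" "pathstart g = p s" "pathfinish g = q s"
    and "path_in B h" "pathstart h = p t" "pathfinish h = q t"
  shows "cover_cong X \<U> ((p \<circ> linepath s t) +++ h) (g +++ (q \<circ> linepath s t))"
  using assms unfolding cong_nearby_def by blast

text \<open>Interval bisection replaces the subdivision of \<open>[0, 1]\<close> given by a Lebesgue number.\<close>

lemma cover_cong_segment_nearby:
  assumes lpc: "locally path_connected X" and cover: "open_cover X \<U>"
    and p: "p \<in> topspace (loop_space X x)"
    and st: "0 \<le> s" "s \<le> t" "t \<le> 1"
  shows "\<exists>A B N. openin (top_of_set X) A \<and> openin (top_of_set X) B \<and> p s \<in> A \<and> p t \<in> B \<and>
    openin (loop_space X x) N \<and> p \<in> N \<and> cong_nearby X \<U> p s t A B N"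
    (is "?P s t")
proof -
  let ?L = "loop_space X x"
  have cont: "continuous_on {0..1} q" and img: "q ` {0..1} \<subseteq> X" and pathq: "path_in X q"
    if "q \<in> topspace ?L" for q
    using that by (auto simp: topspace_loop_space loops_at_def path_def path_image_def path_in_def)
  have seg: "path_in V (q \<circ> linepath a b)"
    if "q \<in> topspace ?L" "0 \<le> a" "a \<le> b" "b \<le> 1" "q ` {a..b} \<subseteq> V" for q V and a b :: real
  proof -
    have "continuous_on {a..b} q"
      using cont[OF that(1)] by (rule continuous_on_subset) (use that in auto)
    then have "path (q \<circ> linepath a b)"
      using that(3) by (intro path_continuous_image) (simp_all add: closed_segment_eq_real_ivl)
    then show ?thesis
      using that by (auto simp: path_in_def path_image_compose closed_segment_eq_real_ivl)
  qed
  \<comment> \<open>The guard belongs to the property being bisected: the local case of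
    \<open>Bolzano\<close> ranges over all short intervals around a point, also those leaving
    \<open>[0, 1]\<close>, where nothing is known about \<open>p\<close>.\<close>
  have "0 \<le> s \<and> t \<le> 1 \<longrightarrow> ?P s t"
    using st(2)
  proof (induction rule: Bolzano)
    case (trans a b c)
    show ?case
    proof
      assume "0 \<le> a \<and> c \<le> 1"
      then have 0: "0 \<le> a" "a \<le> b" "b \<le> c" "c \<le> 1"
        using trans by auto
      then have "?P a b" "?P b c"
        using trans by auto
      then obtain A B N B' C N' where
          A: "openin (top_of_set X) A" "p a \<in> A" and B: "openin (top_of_set X) B" "p b \<in> B"
        and N: "openin ?L N" "p \<in> N" and cong1: "cong_nearby X \<U> p a b A B N"
        and B': "openin (top_of_set X) B'" "p b \<in> B'" and C: "openin (top_of_set X) C" "p c \<in> C"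
        and N': "openin ?L N'" "p \<in> N'" and cong2: "cong_nearby X \<U> p b c B' C N'"
        by blast
      \<comment> \<open>Local path connectedness enters here: if \<open>q b\<close> lies in
        \<open>V\<close>, some path from \<open>p b\<close> to \<open>q b\<close> stays in
        \<open>B \<inter> B'\<close>, and it is an admissible connecting path for both
        halves.\<close>
      obtain V V' where V: "openin (top_of_set X) V" "path_connected V'" "p b \<in> V" "V \<subseteq> V'" "V' \<subseteq> B \<inter> B'"
        using locallyE[OF lpc openin_Int[OF B(1) B'(1)], of "p b"] B B' by blast
      let ?M = "N \<inter> N' \<inter> {q \<in> topspace ?L. q ` {b} \<subseteq> V}"
      have "openin ?L ?M"
        using N N' V 0 by (intro openin_Int openin_loop_space) auto
      moreover have "p \<in> ?M"
        using N N' V p by auto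
      moreover
      have "cover_cong X \<U> ((p \<circ> linepath a c) +++ h) (g +++ (q \<circ> linepath a c))"
        if q: "q \<in> ?M" and g: "path_in A g" "pathstart g = p a" "pathfinish g = q a"
          and h: "path_in C h" "pathstart h = p c" "pathfinish h = q c" for q g h
      proof -
        have "p b \<in> V'" "q b \<in> V'"
          using V(3,4) q by auto
        then obtain k where "path_in V' k" and k: "pathstart k = p b" "pathfinish k = q b"
          using V(2) unfolding path_connected_def path_in_def by metis
        then have kB: "path_in B k" "path_in B' k"
          using V(5) by (auto intro: path_in_mono)
        have in_X: "path_in X g" "path_in X h" "path_in X k"
          using path_in_mono[OF g(1) openin_imp_subset[OF A(1)]]
            path_in_mono[OF h(1) openin_imp_subset[OF C(1)]]
            path_in_mono[OF kB(1) openin_imp_subset[OF B(1)]] by blast+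
        have qL: "q \<in> topspace ?L"
          using q by simp
        define p1 p2 q1 q2 where "p1 = p \<circ> linepath a b" "p2 = p \<circ> linepath b c"
          "q1 = q \<circ> linepath a b" "q2 = q \<circ> linepath b c"
        note defs = p1_p2_q1_q2_def
        have segX: "path_in X (r \<circ> linepath d e)"
          if "r \<in> topspace ?L" "0 \<le> d" "d \<le> e" "e \<le> 1" for r d e
        proof -
          have "r ` {d..e} \<subseteq> r ` {0..1}"
            using that by (intro image_mono) auto
          then show ?thesis
            using that img by (intro seg) blast+
        qed
        have paths: "path_in X p1" "path_in X p2" "path_in X q1" "path_in X q2"
          unfolding defs using 0 p qL by (simp_all add: segX)
        have ends: "pathstart p1 = p a" "pathfinish p1 = p b" "pathstart p2 = p b" "pathfinish p2 = p c"
            "pathstart q1 = q a" "pathfinish q1 = q b" "pathstart q2 = q b" "pathfinish q2 = q c"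
          by (simp_all add: defs pathstart_compose pathfinish_compose)
        have split: "path_class X (r \<circ> linepath a c) =
            path_class X ((r \<circ> linepath a b) +++ (r \<circ> linepath b c))" if "r \<in> topspace ?L" for r
          using homotopic_paths_join_segments[OF pathq[OF that], of a b c] 0
          by (intro path_class_eqI[OF homotopic_paths_sym]) auto
        have ac: "path_in X (p \<circ> linepath a c)" "path_in X (q \<circ> linepath a c)"
          using 0 p qL by (simp_all add: segX)
        have ac_ends: "pathstart (p \<circ> linepath a c) = p a" "pathfinish (p \<circ> linepath a c) = p c"
            "pathstart (q \<circ> linepath a c) = q a" "pathfinish (q \<circ> linepath a c) = q c"
          by (simp_all add: pathstart_compose pathfinish_compose)
        \<comment> \<open>The chain goes from \<open>p1 +++ p2 +++ h\<close> to
          \<open>p1 +++ k +++ q2\<close> by the right half, and from there to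
          \<open>g +++ q1 +++ q2\<close> by the left half; the other links are homotopies that
          rebracket joins or split a segment at \<open>b\<close>.\<close>
        have "path_class X ((p \<circ> linepath a c) +++ h) = path_class X (p1 +++ p2 +++ h)"
          using ac ac_ends paths ends in_X h split[OF p]
          by (simp add: path_class_join flip: defs)
        then have "cover_cong X \<U> ((p \<circ> linepath a c) +++ h) (p1 +++ p2 +++ h)"
          using ac ac_ends in_X h by (intro cover_cong_class) auto
        moreover have "cover_cong X \<U> (p1 +++ p2 +++ h) (p1 +++ k +++ q2)"
          using cong_nearbyD[OF cong2, of q k h] q kB k h ends
          by (intro cover_cong.join[OF cover_cong_refl[OF paths(1)]]) (simp_all flip: defs)
        moreover have "path_class X (p1 +++ k +++ q2) = path_class X ((p1 +++ k) +++ q2)"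
          using paths ends in_X k by (simp add: path_class_join)
        then have "cover_cong X \<U> (p1 +++ k +++ q2) ((p1 +++ k) +++ q2)"
          using paths ends in_X k by (intro cover_cong_class) auto
        moreover have "cover_cong X \<U> ((p1 +++ k) +++ q2) ((g +++ q1) +++ q2)"
          using cong_nearbyD[OF cong1, of q g k] q kB k g ends
          by (intro cover_cong.join[OF _ cover_cong_refl[OF paths(4)]]) (simp_all flip: defs)
        moreover have "path_class X ((g +++ q1) +++ q2) = path_class X (g +++ (q \<circ> linepath a c))"
          using ac ac_ends paths ends in_X g split[OF qL]
          by (simp add: path_class_join flip: defs)
        then have "cover_cong X \<U> ((g +++ q1) +++ q2) (g +++ (q \<circ> linepath a c))"
          using paths ends in_X g by (intro cover_cong_class) auto
        ultimately show ?thesis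
          by (blast intro: cover_cong.trans)
      qed
      then have "cong_nearby X \<U> p a c A C ?M"
        unfolding cong_nearby_def by blast
      ultimately show "?P a c"
        using A C by blast
    qed
  next
    case (local z)
    then have z: "z \<in> {0..1}"
      using st by auto
    then have "p z \<in> X"
      using img[OF p] by auto
    then obtain U where U: "U \<in> \<U>" "openin (top_of_set X) U" "p z \<in> U"
      using cover by (auto simp: open_cover_def)
    have "openin (top_of_set {0..1}) ({0..1} \<inter> p -` U)"
      using cont[OF p] img[OF p] U(2) by (auto intro: continuous_openin_preimage)
    then obtain d where d: "d > 0" "\<And>y. y \<in> {0..1} \<Longrightarrow> dist y z < d \<Longrightarrow> p y \<in> U"
      using z U(3) unfolding openin_euclidean_subtopology_iff by blast
    show ?case
    proof (intro exI[of _ d] conjI allI impI)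
      fix a b assume ab: "a \<le> z \<and> z \<le> b \<and> b - a < d" "0 \<le> a \<and> b \<le> 1"
      \<comment> \<open>Near \<open>z\<close> one member \<open>U\<close> of the cover contains the
        segment of \<open>p\<close>. With \<open>U\<close> also as both end neighbourhoods, the two
        paths to be compared lie in \<open>U\<close>, and the rule \<open>small\<close>
        applies.\<close>
      let ?N = "{q \<in> topspace ?L. q ` {a..b} \<subseteq> U}"
      have "openin ?L ?N"
        using ab U by (intro openin_loop_space) auto
      moreover have pN: "p \<in> ?N"
        using ab d(2) p by (auto simp: dist_real_def)
      moreover have "p a \<in> U" "p b \<in> U"
        using pN ab by auto
      moreover
      have "cover_cong X \<U> ((p \<circ> linepath a b) +++ h) (g +++ (q \<circ> linepath a b))"
        if "q \<in> ?N" "path_in U g" "pathstart g = p a" "pathfinish g = q a"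
          "path_in U h" "pathstart h = p b" "pathfinish h = q b" for q g h
        using that pN ab U seg[of p a b U] seg[of q a b U]
        by (intro cover_cong.small[of U]) (auto simp: pathstart_compose pathfinish_compose)
      then have "cong_nearby X \<U> p a b U U ?N"
        unfolding cong_nearby_def by blast
      ultimately show "?P a b"
        using U(2) by blast
    qed (use d in auto)
  qed
  then show ?thesis
    using st by blast
qed

text \<open>This is the segment result on all of \<open>[0, 1]\<close>. All loops involved start and
  end at \<open>x\<close>, so the connecting paths can be taken constant and then absorbed.\<close>

lemma cover_cong_nearby:
  assumes "locally path_connected X" "open_cover X \<U>" "p \<in> topspace (loop_space X x)"
  shows "\<exists>N. openin (loop_space X x) N \<and> p \<in> N \<and> (\<forall>q\<in>N. cover_cong X \<U> p q)"
proof -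
  obtain A B N where AB: "p 0 \<in> A" "p 1 \<in> B" and N: "openin (loop_space X x) N" "p \<in> N"
    and cong: "cong_nearby X \<U> p 0 1 A B N"
    using cover_cong_segment_nearby[OF assms order_refl zero_le_one order_refl] by blast
  have loop: "path_in X q" "q 0 = x" "q 1 = x" if "q \<in> topspace (loop_space X x)" for q
    using that by (auto simp: topspace_loop_space loops_at_iff_path_in pathstart_def pathfinish_def)
  have "cover_cong X \<U> p q" if "q \<in> N" for q
  proof -
    have qL: "q \<in> topspace (loop_space X x)"
      using N(1) that openin_subset by blast
    let ?c = "\<lambda>_. x"
    note pq = loop[OF assms(3)] loop[OF qL]
    have ends: "pathstart p = x" "pathfinish p = x" "pathstart q = x" "pathfinish q = x"
      using pq by (simp_all add: pathstart_def pathfinish_def)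
    have "cover_cong X \<U> (p +++ ?c) (?c +++ q)"
      using cong_nearbyD[OF cong that, of ?c ?c] AB pq by (simp add: compose_linepath_unit)
    moreover have "cover_cong X \<U> p (p +++ ?c)" "cover_cong X \<U> (?c +++ q) q"
      using pq(1,4) ends path_in_ends_in(1)[OF pq(1)]
      by (intro cover_cong_class; simp add: path_class_simps)+
    ultimately show ?thesis
      by (blast intro: cover_cong.trans)
  qed
  then show ?thesis
    using N by blast
qed


section \<open>The group topology of a congruence\<close>

text \<open>For an equivalence relation \<open>E\<close> on \<open>A\<close> this is the partition
  topology, whose open sets are the unions of classes.\<close>

definition saturated_topology :: "'g set \<Rightarrow> ('g \<times> 'g) set \<Rightarrow> 'g topology" where
  "saturated_topology A E = topology (\<lambda>W. W \<subseteq> A \<and> E `` W \<subseteq> W)"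

lemma openin_saturated_topology: "openin (saturated_topology A E) W \<longleftrightarrow> W \<subseteq> A \<and> E `` W \<subseteq> W"
proof -
  have "istopology (\<lambda>W. W \<subseteq> A \<and> E `` W \<subseteq> W)"
    unfolding istopology_def by blast
  then show ?thesis
    by (simp add: saturated_topology_def)
qed

lemma topspace_saturated_topology:
  assumes "E \<subseteq> A \<times> A"
  shows "topspace (saturated_topology A E) = A"
proof -
  have "openin (saturated_topology A E) A"
    using assms by (auto simp: openin_saturated_topology)
  then show ?thesis
    using openin_saturated_topology[of A E "topspace (saturated_topology A E)"] openin_subset by blast
qed

lemma openin_saturated_topology_class:
  assumes "equiv A E"
  shows "openin (saturated_topology A E) (E `` {a})"
  using assms by (auto simp: openin_saturated_topology equiv_def dest: transD)

text \<open>The class of a point is its smallest open neighbourhood, so continuity of an operation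
  amounts to its compatibility with \<open>E\<close>. Compatibility with inverses follows from that
  with products.\<close>

lemma topological_group_saturated_topology:
  fixes G (structure)
  assumes G: "group G" and E: "equiv (carrier G) E"
    and mult: "\<And>a a' b b'. (a, a') \<in> E \<Longrightarrow> (b, b') \<in> E \<Longrightarrow> (a \<otimes> b, a' \<otimes> b') \<in> E"
  shows "topological_group G (saturated_topology (carrier G) E)"
proof -
  interpret group G by (rule G)
  let ?T = "saturated_topology (carrier G) E"
  have sub: "E \<subseteq> carrier G \<times> carrier G" and refl: "\<And>a. a \<in> carrier G \<Longrightarrow> (a, a) \<in> E"
    and sym: "\<And>a b. (a, b) \<in> E \<Longrightarrow> (b, a) \<in> E"
    using E by (auto simp: equiv_def refl_on_def dest: symD)
  note top = topspace_saturated_topology[OF sub]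
  have inv: "(inv a, inv b) \<in> E" if "(a, b) \<in> E" for a b
  proof -
    have ab: "a \<in> carrier G" "b \<in> carrier G"
      using that sub by auto
    \<comment> \<open>The relation of \<open>b\<close> to \<open>a\<close> is multiplied by
      \<open>inv a\<close> on the left and by \<open>inv b\<close> on the right; what remains
      relates \<open>inv a\<close> to \<open>inv b\<close>.\<close>
    have "(inv a \<otimes> b \<otimes> inv b, inv a \<otimes> a \<otimes> inv b) \<in> E"
      using ab by (intro mult[OF mult[OF refl sym[OF that]] refl]) auto
    then show ?thesis
      using ab by (simp add: m_assoc)
  qed
  note class_open = openin_saturated_topology_class[OF E]
  have "continuous_map (prod_topology ?T ?T) ?T (\<lambda>(a, b). a \<otimes> b)"
    unfolding continuous_map_def
  proof (intro conjI allI impI)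
    fix W assume "openin ?T W"
    then have W: "E `` W \<subseteq> W"
      by (simp add: openin_saturated_topology)
    show "openin (prod_topology ?T ?T)
        {z \<in> topspace (prod_topology ?T ?T). (case z of (a, b) \<Rightarrow> a \<otimes> b) \<in> W}"
      unfolding openin_prod_topology_alt
    proof (intro allI impI)
      fix a b
      assume "(a, b) \<in> {z \<in> topspace (prod_topology ?T ?T). (case z of (a, b) \<Rightarrow> a \<otimes> b) \<in> W}"
      then have ab: "a \<in> carrier G" "b \<in> carrier G" "a \<otimes> b \<in> W"
        by (auto simp: top)
      have "E `` {a} \<times> E `` {b} \<subseteq> {z \<in> topspace (prod_topology ?T ?T). (case z of (a, b) \<Rightarrow> a \<otimes> b) \<in> W}"
      proof (clarsimp simp: top, intro conjI)
        fix a' b' assume E': "(a, a') \<in> E" "(b, b') \<in> E"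
        show "a' \<in> carrier G" "b' \<in> carrier G"
          using E' sub by auto
        show "a' \<otimes> b' \<in> W"
          using mult[OF E'] ab W by blast
      qed
      then show "\<exists>U V. openin ?T U \<and> openin ?T V \<and> a \<in> U \<and> b \<in> V \<and>
          U \<times> V \<subseteq> {z \<in> topspace (prod_topology ?T ?T). (case z of (a, b) \<Rightarrow> a \<otimes> b) \<in> W}"
        using class_open refl ab by blast
    qed
  qed (auto simp: top)
  moreover have "continuous_map ?T ?T (\<lambda>a. inv a)"
    unfolding continuous_map_def
  proof (intro conjI allI impI)
    fix W assume "openin ?T W"
    then have W: "E `` W \<subseteq> W"
      by (simp add: openin_saturated_topology)
    show "openin ?T {a \<in> topspace ?T. inv a \<in> W}"
      unfolding openin_saturated_topology top
    proof (intro conjI subsetI)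
      fix b assume "b \<in> E `` {a \<in> carrier G. inv a \<in> W}"
      then obtain a where a: "(a, b) \<in> E" "inv a \<in> W"
        by blast
      then show "b \<in> {a \<in> carrier G. inv a \<in> W}"
        using inv[OF a(1)] W sub by blast
    qed auto
  qed (auto simp: top)
  ultimately show ?thesis
    by (simp add: topological_group_def top G)
qed


section \<open>Spanier groups at different base points\<close>

definition pi1_cong :: "'a::topological_space set \<Rightarrow> 'a set set \<Rightarrow> 'a
    \<Rightarrow> ((real \<Rightarrow> 'a) set \<times> (real \<Rightarrow> 'a) set) set" where
  "pi1_cong X \<U> x =
     {(path_class X p, path_class X q) | p q. p \<in> loops_at X x \<and> q \<in> loops_at X x \<and> cover_cong X \<U> p q}"

text \<open>Homotopic paths are congruent, so the choice of representatives in
  \<open>pi1_cong\<close> does not matter.\<close>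

lemma pi1_cong_iff:
  assumes "p \<in> loops_at X x" "q \<in> loops_at X x"
  shows "(path_class X p, path_class X q) \<in> pi1_cong X \<U> x \<longleftrightarrow> cover_cong X \<U> p q"
proof
  assume "(path_class X p, path_class X q) \<in> pi1_cong X \<U> x"
  then obtain p' q' where "path_class X p = path_class X p'" "path_class X q' = path_class X q"
      "q' \<in> loops_at X x" "cover_cong X \<U> p' q'"
    unfolding pi1_cong_def by force
  then show "cover_cong X \<U> p q"
    using assms by (meson cover_cong.trans cover_cong_class loops_at_iff_path_in)
qed (use assms in \<open>auto simp: pi1_cong_def\<close>)

lemma equiv_pi1_cong: "equiv (carrier (pi1 X x)) (pi1_cong X \<U> x)"
proof (rule equivI)
  show "pi1_cong X \<U> x \<subseteq> carrier (pi1 X x) \<times> carrier (pi1 X x)"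
    by (auto simp: pi1_cong_def pi1_def)
  show "refl_on (carrier (pi1 X x)) (pi1_cong X \<U> x)"
    by (auto simp: refl_on_def pi1_def pi1_cong_iff loops_at_iff_path_in cover_cong_refl)
  show "sym (pi1_cong X \<U> x)"
    by (auto simp: sym_def pi1_cong_def intro: cover_cong_sym)
  show "trans (pi1_cong X \<U> x)"
  proof (rule transI)
    fix a b c assume "(a, b) \<in> pi1_cong X \<U> x" "(b, c) \<in> pi1_cong X \<U> x"
    moreover from this obtain p q r where "a = path_class X p" "b = path_class X q" "c = path_class X r"
        "p \<in> loops_at X x" "q \<in> loops_at X x" "r \<in> loops_at X x"
      unfolding pi1_cong_def by blast
    ultimately show "(a, c) \<in> pi1_cong X \<U> x"
      by (auto simp: pi1_cong_iff intro: cover_cong.trans)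
  qed
qed

lemma pi1_cong_mult:
  assumes "(a, a') \<in> pi1_cong X \<U> x" "(b, b') \<in> pi1_cong X \<U> x"
  shows "(a \<otimes>\<^bsub>pi1 X x\<^esub> b, a' \<otimes>\<^bsub>pi1 X x\<^esub> b') \<in> pi1_cong X \<U> x"
proof -
  obtain p p' q q' where "a = path_class X p" "a' = path_class X p'" "b = path_class X q"
      "b' = path_class X q'" "cover_cong X \<U> p p'" "cover_cong X \<U> q q'"
    and loops: "p \<in> loops_at X x" "p' \<in> loops_at X x" "q \<in> loops_at X x" "q' \<in> loops_at X x"
    using assms unfolding pi1_cong_def by blast
  moreover have "pathfinish p = pathstart q"
    using loops by (simp add: loops_at_iff_path_in)
  ultimately show ?thesis
    by (simp add: pi1_mult_path_class pi1_cong_iff loops_at_join cover_cong.join)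
qed

text \<open>The preimage of a saturated set in the loop space contains, with each loop, a whole
  neighbourhood of loops congruent to it, and is therefore open.\<close>

lemma coarser_saturated_pi1_cong:
  assumes "locally path_connected X" "open_cover X \<U>"
  shows "coarser (saturated_topology (carrier (pi1 X x)) (pi1_cong X \<U> x)) (pi1_qtop X x)"
proof -
  let ?E = "pi1_cong X \<U> x" and ?L = "loop_space X x"
  have "?E \<subseteq> carrier (pi1 X x) \<times> carrier (pi1 X x)"
    by (auto simp: pi1_cong_def pi1_def)
  note top = topspace_saturated_topology[OF this]
  have "openin (pi1_qtop X x) W" if W: "W \<subseteq> carrier (pi1 X x)" "?E `` W \<subseteq> W" for W
  proof -
    have "openin ?L {p \<in> topspace ?L. path_class X p \<in> W}"
    proof (subst openin_subopen, intro ballI)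
      fix p assume p: "p \<in> {p \<in> topspace ?L. path_class X p \<in> W}"
      then obtain N where N: "openin ?L N" "p \<in> N" "\<And>q. q \<in> N \<Longrightarrow> cover_cong X \<U> p q"
        using cover_cong_nearby[OF assms, of p x] by auto
      have "path_class X q \<in> W" if "q \<in> N" for q
      proof -
        have "q \<in> loops_at X x" "p \<in> loops_at X x"
          using that p openin_subset[OF N(1)] by (auto simp: topspace_loop_space)
        then have "(path_class X p, path_class X q) \<in> ?E"
          using N(3)[OF that] by (simp add: pi1_cong_iff)
        then show ?thesis
          using W(2) p by blast
      qed
      then show "\<exists>T. openin ?L T \<and> p \<in> T \<and> T \<subseteq> {p \<in> topspace ?L. path_class X p \<in> W}"
        using N openin_subset by blast
    qed
    moreover have "path_class X ` topspace ?L = carrier (pi1 X x)"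
      using quotient_imp_surjective_map[OF quotient_map_quotient_topology] topspace_pi1_qtop
      unfolding pi1_qtop_def by metis
    ultimately show ?thesis
      using W(1) by (simp add: pi1_qtop_def openin_quotient_topology)
  qed
  then show ?thesis
    by (auto simp: coarser_def top topspace_pi1_qtop openin_saturated_topology)
qed

text \<open>The saturated topology competes in the definition of \<open>pi1_tau\<close>, so the
  congruence class of the constant loop is open there. Being nonempty, it is the whole
  group.\<close>

lemma indiscrete_imp_cover_cong_const:
  assumes "locally path_connected X" "open_cover X \<U>" "x \<in> X" "indiscrete (pi1_tau X x)"
    and p: "p \<in> loops_at X x"
  shows "cover_cong X \<U> p (\<lambda>_. x)"
proof -
  let ?E = "pi1_cong X \<U> x" and ?c = "\<lambda>_. x"
  let ?T = "saturated_topology (carrier (pi1 X x)) ?E"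
  have c: "?c \<in> loops_at X x"
    using assms(3) by (rule loops_at_const)
  have "topological_group (pi1 X x) ?T"
    using group_pi1[OF assms(3)] equiv_pi1_cong pi1_cong_mult
    by (rule topological_group_saturated_topology)
  then have "coarser ?T (pi1_tau X x)"
    using pi1_tau(3)[OF assms(3)] coarser_saturated_pi1_cong[OF assms(1,2)] by blast
  moreover have "openin ?T (?E `` {path_class X ?c})"
    by (rule openin_saturated_topology_class[OF equiv_pi1_cong])
  ultimately have "openin (pi1_tau X x) (?E `` {path_class X ?c})"
    by (simp add: coarser_def)
  moreover have "path_class X ?c \<in> ?E `` {path_class X ?c}"
    using c assms(3) by (simp add: pi1_cong_iff cover_cong_refl)
  moreover have "topspace (pi1_tau X x) = carrier (pi1 X x)"
    using pi1_tau(1)[OF assms(3)] by (simp add: topological_group_def)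
  moreover have "openin (pi1_tau X x) W \<Longrightarrow> W = {} \<or> W = topspace (pi1_tau X x)" for W
    using assms(4) unfolding indiscrete_def by simp
  ultimately have "?E `` {path_class X ?c} = carrier (pi1 X x)"
    by (metis empty_iff)
  moreover have "path_class X p \<in> carrier (pi1 X x)"
    using p by (simp add: pi1_def)
  ultimately have "(path_class X ?c, path_class X p) \<in> ?E"
    by blast
  then show ?thesis
    using c p by (simp add: pi1_cong_iff cover_cong_sym)
qed

section \<open>Change of base point and conclusion\<close>

lemma cover_cong_const_change_base:
  assumes x: "\<And>p. p \<in> loops_at X x \<Longrightarrow> cover_cong X \<U> p (\<lambda>_. x)"
    and g: "path_in X g" "pathstart g = x" "pathfinish g = y"
    and q: "q \<in> loops_at X y"
  shows "cover_cong X \<U> q (\<lambda>_. y)"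
proof -
  \<comment> \<open>Conjugation by \<open>g\<close> makes \<open>q\<close> a loop at
    \<open>x\<close>, which is congruent to a constant by assumption; conjugating back gives
    \<open>q\<close> up to homotopy on one side and the constant loop at \<open>y\<close> on the
    other.\<close>
  let ?p = "g +++ q +++ reversepath g"
  have q': "path_in X q" "pathstart q = y" "pathfinish q = y"
    using q by (auto simp: loops_at_iff_path_in)
  have "x \<in> X" "y \<in> X"
    using g path_in_ends_in by blast+
  have "?p \<in> loops_at X x"
    using g q' by (simp add: loops_at_iff_path_in)
  then have "cover_cong X \<U> (reversepath g +++ ?p +++ g) (reversepath g +++ (\<lambda>_. x) +++ g)"
    using g q' x by (intro cover_cong.join cover_cong_refl) auto
  moreover have "cover_cong X \<U> q (reversepath g +++ ?p +++ g)"
    using g q' by (intro cover_cong_class) (auto simp: path_class_simps)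
  moreover have "cover_cong X \<U> (reversepath g +++ (\<lambda>_. x) +++ g) (\<lambda>_. y)"
    using g \<open>x \<in> X\<close> by (intro cover_cong_class) (auto simp: path_class_simps)
  ultimately show ?thesis
    by (blast intro: cover_cong.trans)
qed

theorem corollary5p2:
  fixes X :: "'a::topological_space set" and x :: 'a
  assumes "connected X"
    and "locally path_connected X"
    and "x \<in> X"
    and "indiscrete (pi1_tau X x)"
  shows "spanier_space X"
  unfolding spanier_space_def
proof (intro ballI equalityI spanier_group_subset_carrier)
  fix y assume y: "y \<in> X"
  \<comment> \<open>Connectedness is used here: in a locally path connected space, components and
    path components agree.\<close>
  have "path_component X x y"
    using assms(1-3) y by (simp add: path_component_eq_connected_component connected_iff_connected_component)
  then obtain g where g: "path_in X g" "pathstart g = x" "pathfinish g = y"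
    by (auto simp: path_component_def path_in_def)
  have "path_class X q \<in> spanier_group_cover X \<U> y"
    if q: "q \<in> loops_at X y" and \<U>: "open_cover X \<U>" for q \<U>
  proof (rule cover_cong_const_imp_spanier)
    show "cover_cong X \<U> q (\<lambda>_. y)"
      using indiscrete_imp_cover_cong_const[OF assms(2) \<U> assms(3,4)] g q
      by (rule cover_cong_const_change_base)
    show "\<Union>\<U> \<subseteq> X"
      using \<U> by (simp add: open_cover_def)
  qed
  then show "carrier (pi1 X y) \<subseteq> spanier_group X y"
    by (auto simp: pi1_def spanier_group_def)
qed

end
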